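(* For every positive integer $k$, the digraph $\mathbb{Z}(\Theta_\infty,k)$ has polynomial growth of degree $k+1$, has only one end, and is sharply $k$-arc-transitive.
   Context: A digraph $\Gamma$ is a pair $(\mathrm V\Gamma,\mathrm E\Gamma)$ with $\mathrm E\Gamma\subseteq \mathrm V\Gamma\times \mathrm V\Gamma$ the set of arcs (loops are allowed). A $k$-arc is a sequence $(v_0,\dots,v_k)$ of vertices with $(v_{i-1},v_i)$ an arc for $1\le i\le k$. $\Gamma$ is $k$-arc-transitive if $\mathrm{Aut}(\Gamma)$ acts transitively on the set of $k$-arcs; sharply $k$-arc-transitive means $k$-arc-transitive but not $(k+1)$-arc-transitive. For a digraph $\Delta$ with vertex set $V$ and a positive integer $k$, $\mathbb{Z}(\Delta,k)$ is the digraph with vertex set $\mathbb{Z}\times V^k$ in which the out-neighbours of $(i;v_0,\dots,v_{k-1})$ are the vertices $(i+1;w_0,\dots,w_{k-1})$ such that $v_j=w_j$ if $j\not\equiv i \pmod k$, and $(v_j,w_j)\in \mathrm E\Delta$ if $j\equiv i\pmod k$. $\Theta_\infty$ is the infinite directed line with a loop attached at every vertex (vertex set $\mathbb{Z}$, arcs $(x,x)$ and $(x,x+1)$). A path of length $n$ is a sequence $v_0,a_1,v_1,\dots,a_n,v_n$ with the $v_i$ pairwise distinct vertices and each $a_i$ an arc equal to $(v_{i-1},v_i)$ or $(v_i,v_{i-1})$ (so paths ignore directions); a ray is a one-way infinite path. For a connected digraph and a vertex $v$, $b_n(v)$ is the number of vertices that can be reached from $v$ by a path of length $\le n$. The digraph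 has polynomial growth if there is a polynomial $P$ with $b_n(v)\le P(n)$ for all $n\ge 0$ (this does not depend on the choice of $v$ in the vertex-transitive setting considered here); the lowest possible degree of such a $P$ is the degree of the growth. The ends of a digraph are the equivalence classes of rays, where two rays are equivalent if there is an infinite family of pairwise disjoint paths all with initial vertex in one of the rays and terminal vertex in the other. *)

theory Defs
  imports
    "Graph_Theory.Digraph_Component"
    "HOL-Computational_Algebra.Polynomial"
    "HOL-Number_Theory.Cong"
begin

text \<open>
  Digraphs without parallel arcs, loops allowed, are records of type
  \<^typ>\<open>'a pair_pre_digraph\<close>.
\<close>

(* Only the restriction of an automorphism to the vertex set matters; its values elsewhere
   are unconstrained. *)
definition automorphisms :: "'a pair_pre_digraph \<Rightarrow> ('a \<Rightarrow> 'a) set" where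
  "automorphisms G = {f. bij_betw f (pverts G) (pverts G) \<and>
     (\<forall>u\<in>pverts G. \<forall>v\<in>pverts G. (f u, f v) \<in> parcs G \<longleftrightarrow> (u, v) \<in> parcs G)}"

definition k_arcs :: "'a pair_pre_digraph \<Rightarrow> nat \<Rightarrow> 'a list set" where
  "k_arcs G k = {vs. length vs = Suc k \<and> set vs \<subseteq> pverts G \<and>
     (\<forall>i<k. (vs ! i, vs ! Suc i) \<in> parcs G)}"

definition k_arc_transitive :: "nat \<Rightarrow> 'a pair_pre_digraph \<Rightarrow> bool" where
  "k_arc_transitive k G \<longleftrightarrow>
     (\<forall>a\<in>k_arcs G k. \<forall>b\<in>k_arcs G k. \<exists>f\<in>automorphisms G. map f a = b)"

definition sharply_k_arc_transitive :: "nat \<Rightarrow> 'a pair_pre_digraph \<Rightarrow> bool" where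
  "sharply_k_arc_transitive k G \<longleftrightarrow> k_arc_transitive k G \<and> \<not> k_arc_transitive (Suc k) G"

text \<open>
  The digraph $\mathbb{Z}(\Delta,k)$; elements of $V^k$ are lists of length $k$, with entries
  indexed from $0$.
\<close>

definition Z_digraph :: "'a pair_pre_digraph \<Rightarrow> nat \<Rightarrow> (int \<times> 'a list) pair_pre_digraph" where
  "Z_digraph D k =
     (let V = {(i, v). length v = k \<and> set v \<subseteq> pverts D} in
      \<lparr> pverts = V,
        parcs = {((i, v), (i', w)) | i v i' w. (i, v) \<in> V \<and> (i', w) \<in> V \<and> i' = i + 1 \<and>
          (\<forall>j<k. if [int j = i] (mod int k) then (v ! j, w ! j) \<in> parcs D else v ! j = w ! j)} \<rparr>)"

definition Theta_inf :: "int pair_pre_digraph" where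
  "Theta_inf = \<lparr> pverts = UNIV, parcs = {(x, y). y = x \<or> y = x + 1} \<rparr>"

text \<open>
  Paths and rays ignore directions but record which arcs are used: $v_0, a_1, v_1, \ldots, a_n, v_n$
  is the pair of lists $([v_0,\ldots,v_n], [a_1,\ldots,a_n])$.  Thus the arc $a_{i+1}$ joining
  $v_i$ and $v_{i+1}$ has index $i$.
\<close>

definition joins :: "'a pair_pre_digraph \<Rightarrow> 'a \<times> 'a \<Rightarrow> 'a \<Rightarrow> 'a \<Rightarrow> bool" where
  "joins G a u v \<longleftrightarrow> a \<in> parcs G \<and> (a = (u, v) \<or> a = (v, u))"

definition upaths :: "'a pair_pre_digraph \<Rightarrow> ('a list \<times> ('a \<times> 'a) list) set" where
  "upaths G = {(vs, as). length vs = Suc (length as) \<and> set vs \<subseteq> pverts G \<and> distinct vs \<and>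
     (\<forall>i<length as. joins G (as ! i) (vs ! i) (vs ! Suc i))}"

definition rays :: "'a pair_pre_digraph \<Rightarrow> ((nat \<Rightarrow> 'a) \<times> (nat \<Rightarrow> 'a \<times> 'a)) set" where
  "rays G = {(r, as). range r \<subseteq> pverts G \<and> inj r \<and> (\<forall>i. joins G (as i) (r i) (r (Suc i)))}"

definition reach_within :: "'a pair_pre_digraph \<Rightarrow> 'a \<Rightarrow> nat \<Rightarrow> 'a set" where
  "reach_within G v n =
     {w. \<exists>(vs, as)\<in>upaths G. length as \<le> n \<and> hd vs = v \<and> last vs = w}"

(* Finiteness is required explicitly because card is 0 on infinite sets. *)
definition growth_bound :: "'a pair_pre_digraph \<Rightarrow> 'a \<Rightarrow> real poly \<Rightarrow> bool" where
  "growth_bound G v P \<longleftrightarrow>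
     (\<forall>n. finite (reach_within G v n) \<and> real (card (reach_within G v n)) \<le> poly P (real n))"

text \<open>
  Growth is considered for connected digraphs only.  In the vertex-transitive case the choice
  of the base vertex is irrelevant; here the condition is imposed at every vertex.
\<close>

definition polynomial_growth_of_degree :: "'a pair_pre_digraph \<Rightarrow> nat \<Rightarrow> bool" where
  "polynomial_growth_of_degree G d \<longleftrightarrow> connected (with_proj G) \<and>
     (\<forall>v\<in>pverts G. (\<exists>P. growth_bound G v P \<and> degree P = d) \<and>
                    (\<forall>P. growth_bound G v P \<longrightarrow> d \<le> degree P))"

definition equivalent_rays ::
    "'a pair_pre_digraph \<Rightarrow> ((nat \<Rightarrow> 'a) \<times> (nat \<Rightarrow> 'a \<times> 'a)) rel" where
  "equivalent_rays G = {(R, S). R \<in> rays G \<and> S \<in> rays G \<and>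
     (\<exists>F \<subseteq> upaths G. infinite F \<and> pairwise (\<lambda>p q. disjnt (set (fst p)) (set (fst q))) F \<and>
        (\<forall>p\<in>F. hd (fst p) \<in> range (fst R) \<and> last (fst p) \<in> range (fst S)))}"

definition ends :: "'a pair_pre_digraph \<Rightarrow> ((nat \<Rightarrow> 'a) \<times> (nat \<Rightarrow> 'a \<times> 'a)) set set" where
  "ends G = rays G // equivalent_rays G"

end

theory Submission
  imports Defs
begin

text \<open>
  Vertices are points \<open>(i; v)\<close> of \<open>\<int> \<times> \<int>\<^sup>k\<close>; an arc raises the level \<open>i\<close> by one and may raise
  coordinate \<open>i mod k\<close> by one.  Any vertex of a cube of side \<open>m\<close> is thus reached in \<open>O(m)\<close> steps,
  while \<open>n\<close> steps never leave a cube of side \<open>2 n + 1\<close>: growth has degree \<open>k + 1\<close>.  The complement of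
  a box is connected, so any two rays are joined by infinitely many disjoint paths, chosen greedily.
  A \<open>k\<close>-arc makes exactly one binary choice per coordinate, and these choices can be altered
  independently by automorphisms that reflect a coordinate against its number of possible changes.
\<close>

section \<open>Walks in the underlying undirected graph\<close>

text \<open>Steps ignore direction and stay inside a vertex set, so that one relation serves both
  for connectedness of the whole digraph and for connectedness outside a finite set. Its powers
  count steps.\<close>

definition adj_on :: "'a pair_pre_digraph \<Rightarrow> 'a set \<Rightarrow> 'a rel" where
  "adj_on G A = {(u, v). u \<in> A \<and> v \<in> A \<and> ((u, v) \<in> parcs G \<or> (v, u) \<in> parcs G)}"

lemma relpow_adj_on_sym:
  "(u, v) \<in> adj_on G A ^^ n \<Longrightarrow> (v, u) \<in> adj_on G A ^^ n"
proof (induction n arbitrary: v)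
  case (Suc n)
  then obtain w where "(u, w) \<in> adj_on G A ^^ n" "(w, v) \<in> adj_on G A"
    by auto
  then have "(v, w) \<in> adj_on G A" "(w, u) \<in> adj_on G A ^^ n"
    using Suc.IH by (auto simp: adj_on_def)
  then show ?case
    by (rule relpow_Suc_I2)
qed auto

lemma rtrancl_adj_on_sym:
  "(u, v) \<in> (adj_on G A)\<^sup>* \<Longrightarrow> (v, u) \<in> (adj_on G A)\<^sup>*"
  by (metis relpow_adj_on_sym rtrancl_imp_relpow relpow_imp_rtrancl)

lemma connectedI:
  assumes "pverts G \<noteq> {}"
    and "\<And>u v. u \<in> pverts G \<Longrightarrow> v \<in> pverts G \<Longrightarrow> (u, v) \<in> (adj_on G (pverts G))\<^sup>*"
  shows "connected (with_proj G)"
proof -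
  have "u \<rightarrow>\<^sup>*\<^bsub>with_proj (mk_symmetric (with_proj G))\<^esub> v"
    if "u \<in> pverts G" "v \<in> pverts G" for u v
    unfolding reachable_def
    using assms(2)[OF that]
  proof (induction rule: rtrancl_induct)
    case base
    then show ?case using that by (auto intro: rtrancl_on_refl)
  next
    case (step y z)
    then show ?case
      by (auto simp: adj_on_def parcs_mk_symmetric intro!: rtrancl_on_into_rtrancl_on[of u y])
  qed
  then show ?thesis
    using assms(1) by (simp add: connected_def strongly_connected_def)
qed

text \<open>Induction along the walk: a new vertex extends the path, a repeated one cuts the path
  back to its earlier occurrence. Neither operation leaves \<open>A\<close> or makes the path longer
  than the walk.\<close>

lemma upath_of_walk:
  assumes "(u, v) \<in> adj_on G A ^^ n" "u \<in> A" "A \<subseteq> pverts G"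
  shows "\<exists>(vs, as)\<in>upaths G. length as \<le> n \<and> hd vs = u \<and> last vs = v \<and> set vs \<subseteq> A"
  using assms(1)
proof (induction n arbitrary: v)
  case 0
  then have "([u], []) \<in> upaths G"
    using assms by (auto simp: upaths_def)
  then show ?case using 0 assms by force
next
  case (Suc n)
  then obtain w where w: "(u, w) \<in> adj_on G A ^^ n" "(w, v) \<in> adj_on G A"
    by auto
  then obtain vs as where p: "(vs, as) \<in> upaths G" "length as \<le> n" "hd vs = u" "last vs = w"
      "set vs \<subseteq> A"
    using Suc.IH by blast
  then have len: "length vs = Suc (length as)" and dist: "distinct vs"
    and J: "\<And>i. i < length as \<Longrightarrow> joins G (as ! i) (vs ! i) (vs ! Suc i)"
    by (auto simp: upaths_def)
  have "vs \<noteq> []" using len by auto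
  show ?case
  proof (cases "v \<in> set vs")
    case True
    then obtain m where m: "m \<le> length as" "vs ! m = v"
      using len by (metis in_set_conv_nth less_Suc_eq_le)
    have "set (take (Suc m) vs) \<subseteq> pverts G"
      using p(1) by (auto simp: upaths_def dest: in_set_takeD)
    then have "(take (Suc m) vs, take m as) \<in> upaths G"
      using m len dist J by (simp add: upaths_def)
    moreover have "last (take (Suc m) vs) = v"
      using m len by (simp add: take_Suc_conv_app_nth)
    moreover have "hd (take (Suc m) vs) = u"
      using p(3) \<open>vs \<noteq> []\<close> by simp
    moreover have "set (take (Suc m) vs) \<subseteq> A"
      by (rule order_trans[OF set_take_subset p(5)])
    moreover have "length (take m as) \<le> Suc n"
      using p(2) by simp
    ultimately show ?thesis by blast
  next
    case False
    obtain a where a: "joins G a w v"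
      using w(2) by (auto simp: adj_on_def joins_def)
    have lw: "vs ! length as = w"
      using p(4) len \<open>vs \<noteq> []\<close> by (simp add: last_conv_nth)
    have "joins G ((as @ [a]) ! i) ((vs @ [v]) ! i) ((vs @ [v]) ! Suc i)"
      if "i < Suc (length as)" for i
      using that J a lw len by (cases "i = length as") (auto simp: nth_append)
    moreover have "v \<in> A" using w(2) by (auto simp: adj_on_def)
    ultimately have "(vs @ [v], as @ [a]) \<in> upaths G"
      using False p(1) len dist assms(3) by (auto simp: upaths_def)
    moreover have "length (as @ [a]) \<le> Suc n" "hd (vs @ [v]) = u" "last (vs @ [v]) = v"
        "set (vs @ [v]) \<subseteq> A"
      using p \<open>v \<in> A\<close> \<open>vs \<noteq> []\<close> by simp_all
    ultimately show ?thesis by blast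
  qed
qed

text \<open>A finite set may cut off a finite piece of the digraph, so it is first enlarged to a set
  \<open>Y\<close> with connected complement. A ray has infinitely many vertices, so both rays still
  meet that complement.\<close>

lemma equivalent_rays_if_connected_outside_finite:
  assumes R: "R \<in> rays G" and S: "S \<in> rays G"
    and conn: "\<And>X. finite X \<Longrightarrow> \<exists>Y. finite Y \<and> X \<subseteq> Y \<and>
      (\<forall>u\<in>pverts G - Y. \<forall>v\<in>pverts G - Y. (u, v) \<in> (adj_on G (pverts G - Y))\<^sup>*)"
  shows "(R, S) \<in> equivalent_rays G"
proof -
  define P where "P X p \<longleftrightarrow> p \<in> upaths G \<and> hd (fst p) \<in> range (fst R) \<and>
    last (fst p) \<in> range (fst S) \<and> set (fst p) \<inter> X = {}" for X p
  have step: "\<exists>p. P X p" if fin: "finite X" for X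
  proof -
    obtain Y where Y: "finite Y" "X \<subseteq> Y"
        "\<forall>u\<in>pverts G - Y. \<forall>v\<in>pverts G - Y. (u, v) \<in> (adj_on G (pverts G - Y))\<^sup>*"
      using conn[OF fin] by blast
    have "\<exists>u \<in> range (fst Q). u \<in> pverts G - Y" if "Q \<in> rays G" for Q
    proof -
      have "inj (fst Q)" "range (fst Q) \<subseteq> pverts G"
        using that by (auto simp: rays_def)
      then have "infinite (range (fst Q))" "range (fst Q) \<subseteq> pverts G"
        by (simp_all add: finite_image_iff)
      moreover from this have "\<not> range (fst Q) \<subseteq> Y"
        using Y(1) finite_subset by blast
      ultimately show ?thesis by blast
    qed
    from this[OF R] this[OF S] obtain u v where uv: "u \<in> range (fst R)" "v \<in> range (fst S)"
        "u \<in> pverts G - Y" "v \<in> pverts G - Y"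
      by blast
    then obtain n where "(u, v) \<in> adj_on G (pverts G - Y) ^^ n"
      using Y(3) by (meson rtrancl_imp_relpow)
    from upath_of_walk[OF this] uv obtain vs as where "(vs, as) \<in> upaths G" "hd vs = u" "last vs = v"
        "set vs \<subseteq> pverts G - Y"
      by blast
    then show ?thesis
      using uv Y(2) unfolding P_def by (intro exI[of _ "(vs, as)"]) auto
  qed
  \<comment> \<open>Each path is chosen to avoid the finitely many vertices of all earlier
    ones.\<close>
  have "\<exists>f. \<forall>n::nat. P (\<Union>m<n. set (fst (f m))) (f n)"
  proof (rule dependent_wellorder_choice[where
        P = "\<lambda>f (n::nat) p. P (\<Union>m<n. set (fst (f m))) p"])
    fix p and f g :: "nat \<Rightarrow> 'a list \<times> ('a \<times> 'a) list" and n
    assume "\<And>m. m < n \<Longrightarrow> f m = g m"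
    then have "(\<Union>m<n. set (fst (f m))) = (\<Union>m<n. set (fst (g m)))" by auto
    then show "P (\<Union>m<n. set (fst (f m))) p = P (\<Union>m<n. set (fst (g m))) p" by simp
  next
    fix n :: nat and f :: "nat \<Rightarrow> 'a list \<times> ('a \<times> 'a) list"
    show "\<exists>p. P (\<Union>m<n. set (fst (f m))) p"
      by (rule step) auto
  qed
  then obtain f where f: "\<And>n::nat. P (\<Union>m<n. set (fst (f m))) (f n)" by blast
  have disj: "set (fst (f m)) \<inter> set (fst (f n)) = {}" if "m < n" for m n
    using f[of n] that unfolding P_def by blast
  have disj': "set (fst (f m)) \<inter> set (fst (f n)) = {}" if "m \<noteq> n" for m n
    using disj[of m n] disj[of n m] that by (cases "m < n") auto
  \<comment> \<open>Nonempty disjoint vertex sets are distinct, so \<open>f\<close> is injective and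
    its range is an infinite family.\<close>
  have ne: "set (fst (f n)) \<noteq> {}" for n
    using f[of n] by (auto simp: P_def upaths_def)
  have "inj f"
    by (rule injI) (metis disj' ne Int_absorb)
  then have "infinite (range f)"
    by (simp add: finite_image_iff)
  moreover have "pairwise (\<lambda>p q. disjnt (set (fst p)) (set (fst q))) (range f)"
    by (rule pairwise_imageI) (use disj' in \<open>auto simp: disjnt_def\<close>)
  moreover have "range f \<subseteq> upaths G"
      "\<forall>p\<in>range f. hd (fst p) \<in> range (fst R) \<and> last (fst p) \<in> range (fst S)"
    using f by (auto simp: P_def)
  ultimately show ?thesis
    using R S unfolding equivalent_rays_def by blast
qed

lemma automorphism_map_k_arc:
  assumes "f \<in> automorphisms G" "a \<in> k_arcs G n"
  shows "map f a \<in> k_arcs G n"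
proof -
  have "f ` pverts G = pverts G"
    using assms(1) by (auto simp: automorphisms_def bij_betw_def)
  moreover have "a ! i \<in> pverts G" if "i \<le> n" for i
    using assms(2) that by (auto simp: k_arcs_def)
  moreover have "set (map f a) \<subseteq> f ` pverts G"
    using assms(2) by (auto simp: k_arcs_def)
  ultimately show ?thesis
    using assms by (simp add: k_arcs_def automorphisms_def)
qed

section \<open>Forward walks\<close>

lemma pverts_Z_Theta: "pverts (Z_digraph Theta_inf k) = {(i, v). length v = k}"
  by (auto simp: Z_digraph_def Theta_inf_def Let_def)

lemma parcs_Z_Theta:
  "((i, v), (i', w)) \<in> parcs (Z_digraph Theta_inf k) \<longleftrightarrow>
     length v = k \<and> length w = k \<and> i' = i + 1 \<and>
     (\<forall>j<k. w ! j = v ! j \<or> [int j = i] (mod int k) \<and> w ! j = v ! j + 1)"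
proof -
  have "(if [int j = i] (mod int k) then (x, y) \<in> parcs Theta_inf else x = y) \<longleftrightarrow>
      y = x \<or> [int j = i] (mod int k) \<and> y = x + 1" for j x y
    by (auto simp: Theta_inf_def)
  moreover have "pverts Theta_inf = UNIV"
    by (simp add: Theta_inf_def)
  ultimately show ?thesis
    by (simp add: Z_digraph_def Let_def conj_ac)
qed

text \<open>Up to an additive constant, the number of levels below \<open>i\<close> at which an arc may change
  coordinate \<open>j\<close>.\<close>

definition changes :: "nat \<Rightarrow> nat \<Rightarrow> int \<Rightarrow> int" where
  "changes k j i = (i - int j - 1) div int k"

text \<open>The quotients of \<open>d - 1\<close> and \<open>d\<close> by \<open>k\<close> differ
  exactly when \<open>k\<close> divides \<open>d\<close>. The \<open>- 1\<close> in
  \<open>changes\<close> makes a change at level \<open>i\<close> count from level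
  \<open>i + 1\<close> on.\<close>

lemma changes_plus1:
  assumes "k > 0"
  shows "changes k j (i + 1) = changes k j i + (if [int j = i] (mod int k) then 1 else 0)"
proof -
  define d where "d = i - int j"
  have c: "[int j = i] (mod int k) \<longleftrightarrow> int k dvd d"
    unfolding d_def by (metis cong_iff_dvd_diff cong_sym_eq)
  have "d div int k = (d - 1) div int k + (if int k dvd d then 1 else 0)"
  proof (cases "int k dvd d")
    case True
    then obtain q where q: "d = int k * q" by blast
    have "(d - 1) div int k = q - 1"
      by (rule int_div_pos_eq[of _ _ _ "int k - 1"]) (use q assms in \<open>auto simp: algebra_simps\<close>)
    then show ?thesis using q assms by simp
  next
    case False
    define q r where "q = d div int k" and "r = d mod int k"
    have "r \<noteq> 0" "r \<ge> 0"
      using False assms by (auto simp: r_def dvd_eq_mod_eq_0)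
    then have "r > 0" by simp
    moreover have "r < int k" "d = int k * q + r"
      using assms by (auto simp: q_def r_def)
    ultimately have "(d - 1) div int k = q"
      by (intro int_div_pos_eq[of _ _ _ "r - 1"]) auto
    then show ?thesis using False by (simp add: q_def)
  qed
  then show ?thesis
    unfolding c by (simp add: changes_def d_def algebra_simps)
qed

lemma changes_mono: "k > 0 \<Longrightarrow> i \<le> i' \<Longrightarrow> changes k j i \<le> changes k j i'"
  unfolding changes_def by (intro zdiv_mono1) auto

text \<open>Among \<open>k\<close> consecutive levels exactly one is congruent to
  \<open>j\<close>.\<close>

lemma changes_periods:
  assumes "k > 0"
  shows "changes k j (i + int k * m) = changes k j i + m"
proof -
  have "i + int k * m - int j - 1 = (i - int j - 1) + int k * m" by simp
  then have "changes k j (i + int k * m) = ((i - int j - 1) + int k * m) div int k"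
    by (simp only: changes_def)
  then show ?thesis
    using assms by (simp add: changes_def)
qed

text \<open>After a shift by \<open>d\<close> levels, coordinate \<open>j\<close> takes over the
  schedule of coordinate \<open>j - d\<close> modulo \<open>k\<close>. The correction does not
  depend on \<open>t\<close>, so it cancels from differences of counts.\<close>

lemma changes_rotate:
  "changes k j (t + d) = changes k (nat ((int j - d) mod int k)) t - (int j - d) div int k"
  if "k > 0" for t d
proof -
  define q m where "q = (int j - d) div int k" and "m = (int j - d) mod int k"
  have "int j - d = int k * q + m" "m \<ge> 0" using that by (auto simp: q_def m_def)
  then have "t + d - int j - 1 = (t - m - 1) + int k * (- q)" by (simp add: algebra_simps)
  then have "(t + d - int j - 1) div int k = ((t - m - 1) + int k * (- q)) div int k"
    by (simp only:)
  also have "\<dots> = (t - m - 1) div int k - q"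
    using that by (subst div_mult_self2) auto
  finally have "(t + d - int j - 1) div int k = (t - m - 1) div int k - q" .
  then show ?thesis
    using \<open>m \<ge> 0\<close> by (simp add: changes_def flip: q_def m_def)
qed

text \<open>It suffices that each coordinate has enough opportunities to rise: each is raised as
  early as possible and then kept. The walk thus stays between \<open>v\<close> and \<open>w\<close>
  coordinatewise, and only that region has to lie in \<open>A\<close>.\<close>

lemma forward_walk:
  assumes "k > 0" "length v = k" "length w = k"
    and "\<And>j. j < k \<Longrightarrow> v ! j \<le> w ! j"
    and "\<And>j. j < k \<Longrightarrow> w ! j \<le> v ! j + (changes k j (i + int n) - changes k j i)"
    and "\<And>t x. i \<le> t \<Longrightarrow> t \<le> i + int n \<Longrightarrow> length x = k \<Longrightarrow>
          (\<And>j. j < k \<Longrightarrow> v ! j \<le> x ! j \<and> x ! j \<le> w ! j) \<Longrightarrow> (t, x) \<in> A"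
  shows "((i, v), (i + int n, w)) \<in> adj_on (Z_digraph Theta_inf k) A ^^ n"
  using assms(3-6)
proof (induction n arbitrary: w)
  case 0
  then have "v ! j = w ! j" if "j < k" for j
    using that by (metis add.right_neutral diff_self of_nat_0 order_antisym)
  then have "v = w"
    using assms(2) 0 by (auto intro: nth_equalityI)
  then show ?case by simp
next
  case (Suc n)
  define D where "D j = changes k j (i + int n) - changes k j i" for j
  \<comment> \<open>The greedy position after \<open>n\<close> steps: a coordinate has used all its
    \<open>D j\<close> opportunities or has already reached its target. The last step then has to
    raise only coordinates that used every opportunity.\<close>
  define u where "u = map (\<lambda>j. min (w ! j) (v ! j + D j)) [0..<k]"
  have D: "D j \<ge> 0" for j
    unfolding D_def using changes_mono[OF assms(1), of i "i + int n" j] by simp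
  have u: "length u = k" "\<And>j. j < k \<Longrightarrow> u ! j = min (w ! j) (v ! j + D j)"
    by (auto simp: u_def)
  have lo: "v ! j \<le> u ! j" "u ! j \<le> w ! j" if "j < k" for j
    using u(2)[OF that] Suc.prems(2)[OF that] D[of j] by auto
  have mem: "(t, x) \<in> A"
    if "i \<le> t" "t \<le> i + int n" "length x = k" "\<And>j. j < k \<Longrightarrow> v ! j \<le> x ! j \<and> x ! j \<le> u ! j" for t x
    by (rule Suc.prems(4)) (use that lo in \<open>force+\<close>)
  have "((i, v), (i + int n, u)) \<in> adj_on (Z_digraph Theta_inf k) A ^^ n"
    by (rule Suc.IH) (use u lo mem in \<open>auto simp: D_def\<close>)
  moreover have "((i + int n, u), (i + int (Suc n), w)) \<in> adj_on (Z_digraph Theta_inf k) A"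
  proof -
    have "w ! j = u ! j \<or> [int j = i + int n] (mod int k) \<and> w ! j = u ! j + 1" if j: "j < k" for j
    proof -
      have "i + int (Suc n) = (i + int n) + 1" by simp
      then have "w ! j \<le> v ! j + D j + (if [int j = i + int n] (mod int k) then 1 else 0)"
        using Suc.prems(3)[OF j] changes_plus1[OF assms(1), of j "i + int n"]
        by (simp only: D_def)
      then show ?thesis using u(2)[OF j] by (auto split: if_splits)
    qed
    then have "((i + int n, u), (i + int (Suc n), w)) \<in> parcs (Z_digraph Theta_inf k)"
      using u(1) Suc.prems(1) by (simp add: parcs_Z_Theta)
    moreover have "(i + int n, u) \<in> A"
      by (rule mem) (use u lo in auto)
    moreover have "(i + int (Suc n), w) \<in> A"
      by (rule Suc.prems(4)) (use Suc.prems in auto)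
    ultimately show ?thesis by (simp add: adj_on_def)
  qed
  ultimately show ?case by auto
qed


text \<open>Both vertices walk forward to a common vertex, the coordinatewise maximum placed at a
  high enough level, so neither walk goes below its starting level.\<close>

lemma levels_above_connected:
  assumes "k > 0"
    and A: "\<And>t x. i0 \<le> t \<Longrightarrow> length x = k \<Longrightarrow> (t, x) \<in> A"
    and "i0 \<le> i" "length v = k" "i0 \<le> i'" "length v' = k"
  shows "((i, v), (i', v')) \<in> (adj_on (Z_digraph Theta_inf k) A)\<^sup>*"
proof -
  define w where "w = map (\<lambda>j. max (v ! j) (v' ! j)) [0..<k]"
  \<comment> \<open>\<open>p\<close> bounds all coordinate differences, and \<open>T\<close> leaves
    \<open>p\<close> full periods above both levels, enough for \<open>p\<close> changes of every
    coordinate.\<close>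
  define p where "p = nat (Max (insert 0 ((\<lambda>j. \<bar>v ! j - v' ! j\<bar>) ` {..<k})))"
  define T where "T = max i i' + int k * int p"
  have w: "length w = k" "\<And>j. j < k \<Longrightarrow> w ! j = max (v ! j) (v' ! j)"
    by (auto simp: w_def)
  have p: "\<bar>v ! j - v' ! j\<bar> \<le> int p" if "j < k" for j
  proof -
    have "\<bar>v ! j - v' ! j\<bar> \<le> Max (insert 0 ((\<lambda>j. \<bar>v ! j - v' ! j\<bar>) ` {..<k}))"
      using that by (intro Max_ge) auto
    then show ?thesis unfolding p_def by simp
  qed
  have up: "((l, u), (T, w)) \<in> (adj_on (Z_digraph Theta_inf k) A)\<^sup>*"
    if l: "i0 \<le> l" "l \<le> max i i'" and u: "length u = k" "\<And>j. j < k \<Longrightarrow> u ! j \<le> w ! j"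
      "\<And>j. j < k \<Longrightarrow> w ! j \<le> u ! j + int p" for l u
  proof -
    have "int k * int p \<ge> 0" by simp
    then have "l \<le> T" using l(2) unfolding T_def by linarith
    then have T: "l + int (nat (T - l)) = T" by simp
    have "w ! j \<le> u ! j + (changes k j (l + int (nat (T - l))) - changes k j l)" if "j < k" for j
    proof -
      have "changes k j T = changes k j (max i i') + int p"
        unfolding T_def by (rule changes_periods[OF assms(1)])
      moreover have "changes k j l \<le> changes k j (max i i')"
        by (rule changes_mono[OF assms(1) l(2)])
      ultimately show ?thesis
        using u(3)[OF that] by (simp only: T)
    qed
    then have "((l, u), (l + int (nat (T - l)), w)) \<in> adj_on (Z_digraph Theta_inf k) A ^^ nat (T - l)"
      by (intro forward_walk) (use assms(1) u w(1) A l in auto)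
    then show ?thesis
      unfolding T by (rule relpow_imp_rtrancl)
  qed
  have "((i, v), (T, w)) \<in> (adj_on (Z_digraph Theta_inf k) A)\<^sup>*"
    by (rule up) (use assms w p in \<open>force+\<close>)
  moreover have "((i', v'), (T, w)) \<in> (adj_on (Z_digraph Theta_inf k) A)\<^sup>*"
    by (rule up) (use assms w p in \<open>force+\<close>)
  ultimately show ?thesis
    by (blast intro: rtrancl_adj_on_sym rtrancl_trans)
qed

lemma connected_Z_Theta:
  assumes "k > 0"
  shows "connected (with_proj (Z_digraph Theta_inf k))"
proof (rule connectedI)
  have "(0, replicate k 0) \<in> pverts (Z_digraph Theta_inf k)"
    by (simp add: pverts_Z_Theta)
  then show "pverts (Z_digraph Theta_inf k) \<noteq> {}" by blast
next
  fix x y :: "int \<times> int list"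
  assume "x \<in> pverts (Z_digraph Theta_inf k)" "y \<in> pverts (Z_digraph Theta_inf k)"
  moreover obtain i v i' v' where "x = (i, v)" "y = (i', v')"
    by (cases x, cases y)
  ultimately show "(x, y) \<in> (adj_on (Z_digraph Theta_inf k) (pverts (Z_digraph Theta_inf k)))\<^sup>*"
    using levels_above_connected[OF assms, of "min i i'" "pverts (Z_digraph Theta_inf k)" i v i' v']
    by (simp add: pverts_Z_Theta)
qed

section \<open>One end\<close>

definition box :: "nat \<Rightarrow> int \<Rightarrow> (int \<times> int list) set" where
  "box k N = {(i, v). length v = k \<and> \<bar>i\<bar> \<le> N \<and> (\<forall>j<k. \<bar>v ! j\<bar> \<le> N)}"

lemma finite_box: "finite (box k N)"
proof (rule finite_subset)
  have "set v \<subseteq> {-N..N}" if len: "length v = k" and le: "\<forall>j<k. \<bar>v ! j\<bar> \<le> N" for v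
    unfolding set_conv_nth len using le by (auto simp: abs_le_iff minus_le_iff)
  then show "box k N \<subseteq> {-N..N} \<times> {v. set v \<subseteq> {-N..N} \<and> length v = k}"
    by (auto simp: box_def)
  show "finite ({-N..N} \<times> {v. set v \<subseteq> {-N..N} \<and> length v = k})"
    by (intro finite_cartesian_product finite_lists_length_eq) auto
qed

lemma finite_subset_box:
  assumes "finite X"
  obtains N where "X \<inter> {(i, v). length v = k} \<subseteq> box k N"
proof
  define h where "h x = Max (insert \<bar>fst x\<bar> (abs ` set (snd x)))" for x :: "int \<times> int list"
  define N where "N = Max (h ` X)"
  have le: "h x \<le> N" if "x \<in> X" for x
    unfolding N_def using that assms by (intro Max_ge) auto
  have "\<bar>i\<bar> \<le> h (i, v)" for i v
    unfolding h_def by (intro Max_ge) auto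
  then have "\<bar>i\<bar> \<le> N" if "(i, v) \<in> X" for i v
    using le[OF that] by (rule order_trans)
  moreover have *: "\<bar>v ! j\<bar> \<le> h (i, v)" if "j < length v" for i v j
    unfolding h_def using that by (intro Max_ge) auto
  have "\<bar>v ! j\<bar> \<le> N" if "j < length v" "(i, v) \<in> X" for i v j
    by (rule order_trans[OF _ le[OF that(2)]]) (use that(1) * in blast)
  ultimately show "X \<inter> {(i, v). length v = k} \<subseteq> box k N"
    unfolding box_def by blast
qed

text \<open>A vertex with a coordinate beyond \<open>N\<close> can climb to the levels above \<open>N\<close> without changing
  its coordinates; a vertex below level \<open>-N\<close> can first move a coordinate beyond \<open>N\<close>, staying
  below that level by starting far enough down.\<close>

lemma outside_box_connected:
  assumes "k > 0"
    and "x \<in> pverts (Z_digraph Theta_inf k) - box k N"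
    and "y \<in> pverts (Z_digraph Theta_inf k) - box k N"
  shows "(x, y) \<in> (adj_on (Z_digraph Theta_inf k) (pverts (Z_digraph Theta_inf k) - box k N))\<^sup>*"
proof -
  define A where "A = pverts (Z_digraph Theta_inf k) - box k N"
  define C where "C = (adj_on (Z_digraph Theta_inf k) A)\<^sup>*"
  \<comment> \<open>A vertex on the first level above the box; every vertex outside the box gets
    connected to it.\<close>
  define hub where "hub = (N + 1, replicate k (0::int))"
  have A: "(t, x) \<in> A \<longleftrightarrow> length x = k \<and> (t > N \<or> t < - N \<or> (\<exists>j<k. \<bar>x ! j\<bar> > N))" for t x
    by (auto simp: A_def box_def pverts_Z_Theta not_le)
  have trans: "(a, c) \<in> C" if "(a, b) \<in> C" "(b, c) \<in> C" for a b c
    using that unfolding C_def by (rule rtrancl_trans)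
  have sym: "(a, b) \<in> C" if "(b, a) \<in> C" for a b
    using that unfolding C_def by (rule rtrancl_adj_on_sym)
  have above: "((i, v), hub) \<in> C" if "i > N" "length v = k" for i v
    unfolding C_def hub_def
    by (rule levels_above_connected[OF assms(1), where ?i0.0 = "N + 1"]) (use that A in auto)
  have climb: "((i, v), hub) \<in> C" if "length v = k" "j < k" "\<bar>v ! j\<bar> > N" for i v j
  proof (cases "i > N")
    case False
    have eq: "i + int (nat (N + 1 - i)) = N + 1"
      using False by simp
    have "((i, v), (i + int (nat (N + 1 - i)), v)) \<in> adj_on (Z_digraph Theta_inf k) A ^^ nat (N + 1 - i)"
    proof (rule forward_walk)
      fix t x
      assume "length x = k" "\<And>j. j < k \<Longrightarrow> v ! j \<le> x ! j \<and> x ! j \<le> v ! j"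
      then have "x ! j = v ! j" using that(2) by force
      then show "(t, x) \<in> A"
        using that \<open>length x = k\<close> A by auto
    qed (use assms(1) that changes_mono in auto)
    then have "((i, v), (N + 1, v)) \<in> C"
      unfolding eq C_def by (rule relpow_imp_rtrancl)
    then show ?thesis
      by (rule trans) (rule above, use that(1) in auto)
  qed (use that above in auto)
  have below: "((i, v), hub) \<in> C" if "i < - N" "length v = k" for i v
  proof -
    \<comment> \<open>Every coordinate of \<open>w\<close> exceeds \<open>N\<close> in absolute
      value, so \<open>climb\<close> applies to it; \<open>\<bar>N\<bar>\<close> also covers a
      negative \<open>N\<close>.\<close>
    define w where "w = map (\<lambda>j. max (v ! j) (\<bar>N\<bar> + 1)) [0..<k]"
    define p where "p = nat (Max (insert 0 ((\<lambda>j. \<bar>N\<bar> + 1 - v ! j) ` {..<k})))"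
    have w: "length w = k" "\<And>j. j < k \<Longrightarrow> w ! j = max (v ! j) (\<bar>N\<bar> + 1)"
      by (auto simp: w_def)
    have p: "\<bar>N\<bar> + 1 - v ! j \<le> int p" if "j < k" for j
    proof -
      have "\<bar>N\<bar> + 1 - v ! j \<le> Max (insert 0 ((\<lambda>j. \<bar>N\<bar> + 1 - v ! j) ` {..<k}))"
        using that by (intro Max_ge) auto
      then show ?thesis unfolding p_def by simp
    qed
    \<comment> \<open>Descending \<open>p\<close> periods with \<open>v\<close> fixed and ascending
      again leaves room for \<open>p\<close> changes of each coordinate, so the ascent can end in
      \<open>w\<close>. All levels involved are at most \<open>i\<close>, hence below
      \<open>- N\<close>.\<close>
    define l where "l = i - int k * int p"
    have l: "l + int (k * p) = i"
      by (simp add: l_def)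
    have ch: "changes k j i = changes k j l + int p" for j
      using changes_periods[OF assms(1), of j l "int p"] by (simp add: l_def)
    have mem: "(t, x) \<in> A" if "t \<le> l + int (k * p)" "length x = k" for t x
      using that \<open>i < - N\<close> A l by auto
    have "((l, v), (l + int (k * p), v)) \<in> adj_on (Z_digraph Theta_inf k) A ^^ (k * p)"
      by (intro forward_walk[OF assms(1)])
        (use \<open>length v = k\<close> mem changes_mono[OF assms(1), of l "l + int (k * p)"] in auto)
    then have "((l, v), (i, v)) \<in> C"
      unfolding l C_def by (rule relpow_imp_rtrancl)
    moreover have "w ! j \<le> v ! j + (changes k j (l + int (k * p)) - changes k j l)" if "j < k" for j
      unfolding l ch using w(2)[OF that] p[OF that] by simp
    then have "((l, v), (l + int (k * p), w)) \<in> adj_on (Z_digraph Theta_inf k) A ^^ (k * p)"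
      by (intro forward_walk[OF assms(1)]) (use \<open>length v = k\<close> mem w in auto)
    then have "((l, v), (i, w)) \<in> C"
      unfolding l C_def by (rule relpow_imp_rtrancl)
    moreover have "((i, w), hub) \<in> C"
      using climb[of w 0 i] w assms(1) by simp
    ultimately show ?thesis
      using sym trans by blast
  qed
  have "(z, hub) \<in> C" if "z \<in> A" for z
    using that above climb below A by (cases z) auto
  then show ?thesis
    using assms(2,3) sym trans unfolding A_def C_def by blast
qed

lemma rays_Z_Theta_equivalent:
  assumes "k > 0" "R \<in> rays (Z_digraph Theta_inf k)" "S \<in> rays (Z_digraph Theta_inf k)"
  shows "(R, S) \<in> equivalent_rays (Z_digraph Theta_inf k)"
proof (rule equivalent_rays_if_connected_outside_finite[OF assms(2,3)])
  fix X :: "(int \<times> int list) set"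
  assume "finite X"
  then obtain N where N: "X \<inter> {(i, v). length v = k} \<subseteq> box k N"
    by (rule finite_subset_box)
  define V where "V = pverts (Z_digraph Theta_inf k)"
  \<comment> \<open>\<open>X\<close> may contain pairs that are not vertices, so it is kept in the
    removed set; among the vertices only the box is removed.\<close>
  have eq: "V - (X \<union> box k N) = V - box k N"
    using N by (auto simp: V_def pverts_Z_Theta)
  have "\<forall>u\<in>V - (X \<union> box k N). \<forall>v\<in>V - (X \<union> box k N).
      (u, v) \<in> (adj_on (Z_digraph Theta_inf k) (V - (X \<union> box k N)))\<^sup>*"
    unfolding eq unfolding V_def using outside_box_connected[OF assms(1)] by blast
  then show "\<exists>Y. finite Y \<and> X \<subseteq> Y \<and>
      (\<forall>u\<in>pverts (Z_digraph Theta_inf k) - Y. \<forall>v\<in>pverts (Z_digraph Theta_inf k) - Y.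
        (u, v) \<in> (adj_on (Z_digraph Theta_inf k) (pverts (Z_digraph Theta_inf k) - Y))\<^sup>*)"
    using \<open>finite X\<close> finite_box unfolding V_def
    by (intro exI[of _ "X \<union> box k N"]) blast
qed

text \<open>Since any two rays are related, every class is the set of all rays. The ray
  \<open>r\<close>, which climbs through the levels with constant coordinates, shows that there is a
  class at all.\<close>

lemma card_ends_Z_Theta:
  assumes "k > 0"
  shows "card (ends (Z_digraph Theta_inf k)) = 1"
proof -
  define G where "G = Z_digraph Theta_inf k"
  define r where "r n = (int n, replicate k (0::int))" for n :: nat
  have "(r, \<lambda>n. (r n, r (Suc n))) \<in> rays G"
    by (auto simp: rays_def G_def r_def pverts_Z_Theta parcs_Z_Theta joins_def inj_def)
  moreover have "equivalent_rays G `` {R} = rays G" if "R \<in> rays G" for R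
  proof
    show "equivalent_rays G `` {R} \<subseteq> rays G"
      by (auto simp: equivalent_rays_def)
    show "rays G \<subseteq> equivalent_rays G `` {R}"
      using that rays_Z_Theta_equivalent[OF assms] unfolding G_def by blast
  qed
  ultimately have "ends G = {rays G}"
    unfolding ends_def quotient_def by auto
  then show ?thesis by (simp add: G_def)
qed

section \<open>Growth\<close>

text \<open>Otherwise \<open>x ^ d - poly P (c * x)\<close> would have degree \<open>d\<close> and
  leading coefficient 1, hence be at least 1 for all large \<open>x\<close>. The factor
  \<open>c\<close> allows for the number of steps that reach all of a cube of side
  \<open>m\<close>.\<close>

lemma degree_ge_if_dominates_power:
  fixes P :: "real poly"
  assumes "\<And>m::nat. real m ^ d \<le> poly P (c * real m)"
  shows "d \<le> degree P"
proof (rule ccontr)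
  assume "\<not> d \<le> degree P"
  define Q where "Q = pcompose P [:0, c:]"
  define D where "D = monom 1 d + (- Q)"
  have "degree Q \<le> degree P * degree [:0, c:]"
    unfolding Q_def by (rule degree_pcompose_le)
  also have "\<dots> \<le> degree P * 1"
    by (intro mult_le_mono2) (simp add: degree_pCons_eq_if)
  finally have "degree Q < d"
    using \<open>\<not> d \<le> degree P\<close> by simp
  then have "degree D = d"
    unfolding D_def by (subst degree_add_eq_left) (simp_all add: degree_monom_eq)
  then have "lead_coeff D = 1"
    using \<open>degree Q < d\<close> by (simp add: D_def coeff_eq_0)
  then obtain n0 where n0: "\<And>x. x \<ge> n0 \<Longrightarrow> 1 \<le> poly D x"
    using poly_pinfty_gt_lc[of D] by auto
  obtain m :: nat where "real m \<ge> n0"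
    using real_arch_simple by blast
  then have "1 \<le> poly D (real m)" by (rule n0)
  also have "\<dots> = real m ^ d - poly P (c * real m)"
    by (simp add: D_def Q_def poly_monom poly_pcompose mult.commute)
  finally show False using assms[of m] by simp
qed

section \<open>Cubes of displacements and their size\<close>

definition displace :: "int \<times> int list \<Rightarrow> int \<times> int list \<Rightarrow> int \<times> int list" where
  "displace x y = (fst x + fst y, map2 (+) (snd x) (snd y))"

text \<open>The level has its own range \<open>I\<close> because the lower bound on growth uses an
  interval of levels away from 0.\<close>

definition cube :: "nat \<Rightarrow> int set \<Rightarrow> int set \<Rightarrow> (int \<times> int list) set" where
  "cube k I J = I \<times> {d. set d \<subseteq> J \<and> length d = k}"

lemma finite_cube: "finite I \<Longrightarrow> finite J \<Longrightarrow> finite (cube k I J)"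
  by (simp add: cube_def finite_lists_length_eq)

lemma card_cube: "finite J \<Longrightarrow> card (cube k I J) = card I * card J ^ k"
  by (simp add: cube_def card_cartesian_product card_lists_length_eq)

lemma inj_on_displace:
  assumes "length (snd x) = k"
  shows "inj_on (displace x) (cube k I J)"
proof (rule inj_onI)
  fix y z assume yz: "y \<in> cube k I J" "z \<in> cube k I J" "displace x y = displace x z"
  then have len: "length (snd y) = k" "length (snd z) = k"
    by (auto simp: cube_def)
  have eq: "map2 (+) (snd x) (snd y) = map2 (+) (snd x) (snd z)"
    using yz(3) by (simp add: displace_def)
  have "snd y ! j = snd z ! j" if "j < k" for j
    using arg_cong[OF eq, of "\<lambda>l. l ! j"] len assms that by simp
  then have "snd y = snd z"
    using len by (auto intro: nth_equalityI)
  then show "y = z"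
    using yz(3) by (auto simp: displace_def prod_eq_iff)
qed

text \<open>An arc, traversed in either direction, moves the level by one and each coordinate by at
  most one.\<close>

lemma upath_displacement:
  assumes "(vs, as) \<in> upaths (Z_digraph Theta_inf k)" "m < length vs"
  shows "length (snd (vs ! m)) = k \<and> \<bar>fst (vs ! m) - fst (hd vs)\<bar> \<le> int m \<and>
    (\<forall>j<k. \<bar>snd (vs ! m) ! j - snd (hd vs) ! j\<bar> \<le> int m)"
  using assms(2)
proof (induction m)
  case 0
  moreover from 0 have "vs ! 0 \<in> set vs" "hd vs = vs ! 0"
    by (auto simp: hd_conv_nth)
  moreover have "set vs \<subseteq> pverts (Z_digraph Theta_inf k)"
    using assms(1) by (auto simp: upaths_def)
  ultimately have "vs ! 0 \<in> pverts (Z_digraph Theta_inf k)" "hd vs = vs ! 0"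
    by auto
  then show ?case by (auto simp: pverts_Z_Theta)
next
  case (Suc m)
  obtain i v i' w where vw: "vs ! m = (i, v)" "vs ! Suc m = (i', w)"
    by (cases "vs ! m", cases "vs ! Suc m")
  have "joins (Z_digraph Theta_inf k) (as ! m) (vs ! m) (vs ! Suc m)"
    using assms(1) Suc.prems by (auto simp: upaths_def)
  then have arc: "((i, v), (i', w)) \<in> parcs (Z_digraph Theta_inf k) \<or>
      ((i', w), (i, v)) \<in> parcs (Z_digraph Theta_inf k)"
    unfolding vw by (auto simp: joins_def)
  then have "length w = k" "\<bar>i' - i\<bar> \<le> 1"
    by (auto simp: parcs_Z_Theta)
  moreover have "\<bar>w ! j - v ! j\<bar> \<le> 1" if "j < k" for j
    using arc that unfolding parcs_Z_Theta by force
  moreover have "\<bar>i - fst (hd vs)\<bar> \<le> int m" "\<And>j. j < k \<Longrightarrow> \<bar>v ! j - snd (hd vs) ! j\<bar> \<le> int m"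
    using Suc by (auto simp: vw)
  ultimately show ?case
    unfolding vw by (fastforce simp: abs_le_iff)
qed

lemma reach_within_subset:
  assumes "length (snd x) = k"
  shows "reach_within (Z_digraph Theta_inf k) x n \<subseteq>
    displace x ` cube k {- int n..int n} {- int n..int n}"
proof
  fix y assume "y \<in> reach_within (Z_digraph Theta_inf k) x n"
  then obtain vs as where p: "(vs, as) \<in> upaths (Z_digraph Theta_inf k)" "length as \<le> n"
      "hd vs = x" "last vs = y"
    by (auto simp: reach_within_def)
  then have "length vs = Suc (length as)"
    by (auto simp: upaths_def)
  then have "vs ! length as = y"
    using p(4) by (metis diff_Suc_1 last_conv_nth length_0_conv nat.distinct(1))
  then have y: "length (snd y) = k" "\<bar>fst y - fst x\<bar> \<le> int n"
      "\<And>j. j < k \<Longrightarrow> \<bar>snd y ! j - snd x ! j\<bar> \<le> int n"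
    using upath_displacement[OF p(1), of "length as"] \<open>length vs = Suc (length as)\<close> p(2,3)
    by force+
  define d where "d = map (\<lambda>j. snd y ! j - snd x ! j) [0..<k]"
  have "set d \<subseteq> {- int n..int n}"
  proof -
    have "- int n \<le> snd y ! j - snd x ! j \<and> snd y ! j - snd x ! j \<le> int n" if "j < k" for j
      using y(3)[OF that] by linarith
    then show ?thesis by (auto simp: d_def)
  qed
  moreover have "- int n \<le> fst y - fst x" "fst y - fst x \<le> int n"
    using y(2) by linarith+
  ultimately have "(fst y - fst x, d) \<in> cube k {- int n..int n} {- int n..int n}"
    by (simp add: cube_def d_def)
  moreover have "map2 (+) (snd x) d = snd y"
    using assms y(1) by (auto intro!: nth_equalityI simp: d_def)
  then have "displace x (fst y - fst x, d) = y"
    by (simp add: displace_def)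
  ultimately show "y \<in> displace x ` cube k {- int n..int n} {- int n..int n}"
    by (metis imageI)
qed

text \<open>In \<open>k m\<close> forward steps every coordinate can be raised by any amount up to \<open>m\<close>; up to \<open>m\<close>
  backward steps then vary the level.\<close>

lemma reach_within_supset:
  assumes "k > 0" "length (snd x) = k"
  shows "displace x ` cube k {int (k * m) - int m..int (k * m)} {0..int m} \<subseteq>
    reach_within (Z_digraph Theta_inf k) x ((k + 1) * m)"
proof
  define V where "V = pverts (Z_digraph Theta_inf k)"
  fix y assume "y \<in> displace x ` cube k {int (k * m) - int m..int (k * m)} {0..int m}"
  then obtain t d where y: "y = displace x (t, d)" and t: "int (k * m) - int m \<le> t" "t \<le> int (k * m)"
    and d: "set d \<subseteq> {0..int m}" "length d = k"
    by (auto simp: cube_def)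
  obtain i v where x: "x = (i, v)" by (cases x)
  define w where "w = map2 (+) v d"
  have len: "length v = k" "length w = k"
    using assms(2) d(2) by (auto simp: w_def x)
  have w: "v ! j \<le> w ! j" "w ! j \<le> v ! j + int m" if "j < k" for j
  proof -
    have "d ! j \<in> {0..int m}" using d that by (metis nth_mem subsetD)
    then show "v ! j \<le> w ! j" "w ! j \<le> v ! j + int m"
      using that len d(2) by (auto simp: w_def)
  qed
  have ch: "changes k j (i + int (k * m)) = changes k j i + int m" for j
    using changes_periods[OF assms(1), of j i "int m"] by simp
  have "((i, v), (i + int (k * m), w)) \<in> adj_on (Z_digraph Theta_inf k) V ^^ (k * m)"
  proof (rule forward_walk)
    show "w ! j \<le> v ! j + (changes k j (i + int (k * m)) - changes k j i)" if "j < k" for j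
      unfolding ch using w(2)[OF that] by simp
  qed (use assms(1) len w in \<open>auto simp: V_def pverts_Z_Theta\<close>)
  moreover
  \<comment> \<open>The descent from the top level \<open>i + k m\<close> to the level of
    \<open>y\<close>. It reverses a forward walk with constant coordinates, and the range of
    \<open>t\<close> gives \<open>s \<le> m\<close>.\<close>
  define s where "s = nat (int (k * m) - t)"
  have s: "i + t + int s = i + int (k * m)" "s \<le> m"
    using t unfolding s_def by linarith+
  have "((i + t, w), (i + t + int s, w)) \<in> adj_on (Z_digraph Theta_inf k) V ^^ s"
    by (rule forward_walk)
      (use assms(1) len changes_mono[OF assms(1), of "i + t" "i + t + int s"] in
        \<open>auto simp: V_def pverts_Z_Theta\<close>)
  then have "((i + int (k * m), w), (i + t, w)) \<in> adj_on (Z_digraph Theta_inf k) V ^^ s"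
    unfolding s(1) by (rule relpow_adj_on_sym)
  ultimately have "((i, v), (i + t, w)) \<in> adj_on (Z_digraph Theta_inf k) V ^^ (k * m + s)"
    by (rule relpow_trans)
  then have "(x, y) \<in> adj_on (Z_digraph Theta_inf k) V ^^ (k * m + s)"
    by (simp add: x y displace_def w_def)
  moreover have "x \<in> V"
    using len by (simp add: x V_def pverts_Z_Theta)
  ultimately obtain vs as where "(vs, as) \<in> upaths (Z_digraph Theta_inf k)" "hd vs = x" "last vs = y"
      "length as \<le> k * m + s"
    using upath_of_walk[of x y "k * m + s" "Z_digraph Theta_inf k" V] unfolding V_def by blast
  moreover have "k * m + s \<le> (k + 1) * m"
    using s(2) by simp
  ultimately show "y \<in> reach_within (Z_digraph Theta_inf k) x ((k + 1) * m)"
    unfolding reach_within_def by (blast intro: order_trans)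
qed

lemma polynomial_growth_Z_Theta:
  assumes "k > 0"
  shows "polynomial_growth_of_degree (Z_digraph Theta_inf k) (k + 1)"
  unfolding polynomial_growth_of_degree_def
proof (intro conjI ballI allI impI)
  show "connected (with_proj (Z_digraph Theta_inf k))"
    by (rule connected_Z_Theta[OF assms])
next
  fix x assume "x \<in> pverts (Z_digraph Theta_inf k)"
  then have x: "length (snd x) = k"
    by (auto simp: pverts_Z_Theta)
  \<comment> \<open>There are \<open>2 n + 1\<close> values for the level displacement and for each
    of the \<open>k\<close> coordinates.\<close>
  define P :: "real poly" where "P = [:1, 2:] ^ (k + 1)"
  have "growth_bound (Z_digraph Theta_inf k) x P"
    unfolding growth_bound_def
  proof
    fix n
    define Q where "Q = cube k {- int n..int n} {- int n..int n}"
    have fin: "finite Q" unfolding Q_def by (intro finite_cube) auto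
    have sub: "reach_within (Z_digraph Theta_inf k) x n \<subseteq> displace x ` Q"
      unfolding Q_def by (rule reach_within_subset[OF x])
    then have "card (reach_within (Z_digraph Theta_inf k) x n) \<le> card Q"
      using fin by (meson card_image_le card_mono finite_imageI order_trans)
    also have "card Q = (2 * n + 1) ^ (k + 1)"
      unfolding Q_def by (simp add: card_cube nat_add_distrib nat_mult_distrib algebra_simps)
    finally have "real (card (reach_within (Z_digraph Theta_inf k) x n)) \<le> real ((2 * n + 1) ^ (k + 1))"
      by (simp only: of_nat_le_iff)
    also have "\<dots> = poly P (real n)"
      by (simp add: P_def algebra_simps)
    finally show "finite (reach_within (Z_digraph Theta_inf k) x n) \<and>
        real (card (reach_within (Z_digraph Theta_inf k) x n)) \<le> poly P (real n)"
      using sub fin finite_subset by blast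
  qed
  moreover have "degree P = k + 1"
    unfolding P_def by (subst degree_power_eq) auto
  ultimately show "\<exists>P. growth_bound (Z_digraph Theta_inf k) x P \<and> degree P = k + 1" by blast
next
  fix x P assume "x \<in> pverts (Z_digraph Theta_inf k)"
    and P: "growth_bound (Z_digraph Theta_inf k) x P"
  then have x: "length (snd x) = k"
    by (auto simp: pverts_Z_Theta)
  show "k + 1 \<le> degree P"
  proof (rule degree_ge_if_dominates_power)
    fix m :: nat
    \<comment> \<open>The ball of radius \<open>(k + 1) m\<close> contains a displaced copy of
      \<open>Q\<close>, with \<open>m + 1\<close> choices for the level and for each coordinate; the
      scale is therefore \<open>k + 1\<close>.\<close>
    define Q where "Q = cube k {int (k * m) - int m..int (k * m)} {0..int m}"
    have "real m ^ (k + 1) \<le> real ((m + 1) ^ (k + 1))"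
      unfolding of_nat_power by (intro power_mono) auto
    also have "(m + 1) ^ (k + 1) = card Q"
      unfolding Q_def by (simp add: card_cube nat_add_distrib)
    also have "\<dots> = card (displace x ` Q)"
      unfolding Q_def by (rule card_image[OF inj_on_displace[OF x], symmetric])
    also have "real \<dots> \<le> real (card (reach_within (Z_digraph Theta_inf k) x ((k + 1) * m)))"
      using reach_within_supset[OF assms x, of m] P unfolding Q_def growth_bound_def
      by (intro of_nat_mono card_mono) auto
    also have "\<dots> \<le> poly P (real ((k + 1) * m))"
      using P unfolding growth_bound_def by blast
    finally show "real m ^ (k + 1) \<le> poly P (real (k + 1) * real m)"
      by (simp only: of_nat_mult)
  qed
qed

section \<open>Arc-transitivity\<close>

text \<open>The converse of \<open>forward_walk\<close>: each arc raises a coordinate only at a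
  level where \<open>changes\<close> grows as well, and these inequalities add up.\<close>

lemma k_arc_nth:
  assumes "k > 0" "a \<in> k_arcs (Z_digraph Theta_inf k) K" "n \<le> m" "m \<le> K"
  shows "fst (a ! m) = fst (a ! n) + int (m - n) \<and> length (snd (a ! m)) = k \<and>
    (\<forall>j<k. snd (a ! n) ! j \<le> snd (a ! m) ! j \<and>
      snd (a ! m) ! j - snd (a ! n) ! j \<le> changes k j (fst (a ! m)) - changes k j (fst (a ! n)))"
  using assms(3,4)
proof (induction m rule: dec_induct)
  case base
  have "a ! n \<in> pverts (Z_digraph Theta_inf k)"
    using assms(2) base by (auto simp: k_arcs_def)
  then show ?case by (auto simp: pverts_Z_Theta)
next
  case (step m)
  obtain i v i' w where vw: "a ! m = (i, v)" "a ! Suc m = (i', w)"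
    by (cases "a ! m", cases "a ! Suc m")
  have "(a ! m, a ! Suc m) \<in> parcs (Z_digraph Theta_inf k)"
    using assms(2) step.prems by (auto simp: k_arcs_def)
  then have arc: "length w = k" "i' = i + 1"
      "\<And>j. j < k \<Longrightarrow> w ! j = v ! j \<or> [int j = i] (mod int k) \<and> w ! j = v ! j + 1"
    by (auto simp: vw parcs_Z_Theta)
  have "v ! j \<le> w ! j \<and> w ! j - v ! j \<le> changes k j i' - changes k j i" if "j < k" for j
    using arc(3)[OF that] changes_plus1[OF assms(1), of j i] by (auto simp: arc(2))
  moreover have "i = fst (a ! n) + int (m - n)"
      "\<And>j. j < k \<Longrightarrow> snd (a ! n) ! j \<le> v ! j \<and>
        v ! j - snd (a ! n) ! j \<le> changes k j i - changes k j (fst (a ! n))"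
    using step.IH step.prems by (auto simp: vw)
  ultimately show ?case
    unfolding vw using arc(1,2) step.hyps by (fastforce simp: Suc_diff_le)
qed

text \<open>Along \<open>k\<close> arcs each coordinate has a single opportunity to rise. Its total
  increment is therefore a binary choice, and this choice together with the start determines all
  intermediate values.\<close>

lemma k_arc_coordinate:
  assumes k: "k > 0" and a: "a \<in> k_arcs (Z_digraph Theta_inf k) k" and "n \<le> k" "j < k"
  shows "snd (a ! k) ! j - snd (a ! 0) ! j \<in> {0, 1}"
    and "snd (a ! n) ! j = snd (a ! 0) ! j + (snd (a ! k) ! j - snd (a ! 0) ! j) *
      (changes k j (fst (a ! 0) + int n) - changes k j (fst (a ! 0)))"
proof -
  define i where "i = fst (a ! 0)"
  have 0: "fst (a ! n) = i + int n" "fst (a ! k) = i + int k"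
      "snd (a ! 0) ! j \<le> snd (a ! n) ! j"
      "snd (a ! n) ! j - snd (a ! 0) ! j \<le> changes k j (i + int n) - changes k j i"
      "snd (a ! 0) ! j \<le> snd (a ! k) ! j"
      "snd (a ! k) ! j - snd (a ! 0) ! j \<le> changes k j (i + int k) - changes k j i"
    using k_arc_nth[OF k a, of 0 n] k_arc_nth[OF k a, of 0 k] assms(3,4) by (auto simp: i_def)
  have n: "snd (a ! n) ! j \<le> snd (a ! k) ! j"
      "snd (a ! k) ! j - snd (a ! n) ! j \<le> changes k j (i + int k) - changes k j (i + int n)"
    using k_arc_nth[OF k a, of n k] assms(3,4) 0 by auto
  have p: "changes k j (i + int k) = changes k j i + 1"
    using changes_periods[OF k, of j i 1] by simp
  have "changes k j i \<le> changes k j (i + int n)" "changes k j (i + int n) \<le> changes k j (i + int k)"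
    using assms(3) by (auto intro: changes_mono[OF k])
  \<comment> \<open>Position \<open>n\<close> lies before or after the single opportunity; the
    coordinate then agrees with its initial or its final value, respectively.\<close>
  then have cases: "changes k j (i + int n) - changes k j i = 0 \<or> changes k j (i + int n) - changes k j i = 1"
    using p by linarith
  show "snd (a ! k) ! j - snd (a ! 0) ! j \<in> {0, 1}"
    using 0(5,6) p by auto
  show "snd (a ! n) ! j = snd (a ! 0) ! j + (snd (a ! k) ! j - snd (a ! 0) ! j) *
      (changes k j (fst (a ! 0) + int n) - changes k j (fst (a ! 0)))"
    using cases 0(3-6) n p unfolding i_def by auto
qed

section \<open>Automorphisms that shift levels, rotate and reflect coordinates\<close>

definition rotate_index :: "nat \<Rightarrow> int \<Rightarrow> nat \<Rightarrow> nat" where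
  "rotate_index k d j = nat ((int j - d) mod int k)"

lemma rotate_index:
  assumes "k > 0"
  shows "rotate_index k d j < k"
    and "[int (rotate_index k d j) = int j - d] (mod int k)"
    and "j < k \<Longrightarrow> rotate_index k (- d) (rotate_index k d j) = j"
proof -
  have e: "int (rotate_index k d j) = (int j - d) mod int k" for d j
    using assms by (simp add: rotate_index_def)
  show "rotate_index k d j < k"
    using assms e[of d j] by (metis of_nat_0_less_iff of_nat_less_iff pos_mod_bound)
  show "[int (rotate_index k d j) = int j - d] (mod int k)"
    by (simp add: e cong_def)
  assume "j < k"
  have "int (rotate_index k (- d) (rotate_index k d j)) = ((int j - d) mod int k + d) mod int k"
    by (simp add: e)
  also have "\<dots> = int j"
    using \<open>j < k\<close> by (simp add: mod_add_left_eq)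
  finally show "rotate_index k (- d) (rotate_index k d j) = j" by simp
qed

text \<open>Moving up by \<open>d\<close> levels rotates the coordinates.  Where \<open>s\<close> holds, the coordinate is
  reflected against the number of its possible changes so far, which interchanges
  changing and not changing.\<close>

definition twist :: "nat \<Rightarrow> int \<Rightarrow> (nat \<Rightarrow> bool) \<Rightarrow> (nat \<Rightarrow> int) \<Rightarrow> int \<times> int list \<Rightarrow> int \<times> int list"
  where "twist k d s c = (\<lambda>(t, x). (t + d, map (\<lambda>j.
    if s j then changes k j (t + d) + c j - x ! rotate_index k d j
    else x ! rotate_index k d j + c j) [0..<k]))"

text \<open>Coordinate \<open>j\<close> may change at level \<open>t + d\<close> exactly when its
  rotated index may change at level \<open>t\<close>. There the count in \<open>twist\<close> grows
  by one, so reflection turns an increment 0 into 1 and 1 into 0; at other levels both sides stand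
  still.\<close>

lemma twist_arc_iff:
  assumes "k > 0" "length v = k" "length w = k"
  shows "(twist k d s c (t, v), twist k d s c (t', w)) \<in> parcs (Z_digraph Theta_inf k) \<longleftrightarrow>
    ((t, v), (t', w)) \<in> parcs (Z_digraph Theta_inf k)"
proof (cases "t' = t + 1")
  case True
  define r where "r = rotate_index k d"
  define T where "T u x j = (if s j then changes k j (u + d) + c j - x ! r j else x ! r j + c j)"
    for u and x :: "int list" and j
  have cong: "[int j = t + d] (mod int k) \<longleftrightarrow> [int (r j) = t] (mod int k)" for j
  proof -
    have "[int (r j) = t] (mod int k) \<longleftrightarrow> [int j - d = t] (mod int k)"
      using rotate_index(2)[OF assms(1)] unfolding r_def by (metis cong_trans cong_sym)
    also have "\<dots> \<longleftrightarrow> [int j = t + d] (mod int k)"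
      by (simp add: cong_iff_dvd_diff algebra_simps)
    finally show ?thesis by simp
  qed
  have "t + 1 + d = t + d + 1" by simp
  then have ch: "changes k j (t + 1 + d) =
      changes k j (t + d) + (if [int (r j) = t] (mod int k) then 1 else 0)" for j
    by (simp only: changes_plus1[OF assms(1)] cong)
  have "T (t + 1) w j = T t v j \<or> [int j = t + d] (mod int k) \<and> T (t + 1) w j = T t v j + 1 \<longleftrightarrow>
      w ! r j = v ! r j \<or> [int (r j) = t] (mod int k) \<and> w ! r j = v ! r j + 1" for j
    unfolding T_def ch cong by auto
  \<comment> \<open>Rotation permutes the indices below \<open>k\<close>, so the conditions may be
    reindexed.\<close>
  moreover have "(\<forall>j<k. Q (r j)) \<longleftrightarrow> (\<forall>m<k. Q m)" for Q
  proof -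
    have "r j < k" for j
      unfolding r_def by (rule rotate_index(1)[OF assms(1)])
    moreover have "r (rotate_index k (- d) m) = m" if "m < k" for m
      using rotate_index(3)[OF assms(1) that, of "- d"] by (simp add: r_def)
    moreover have "rotate_index k (- d) m < k" for m
      by (rule rotate_index(1)[OF assms(1)])
    ultimately show ?thesis by metis
  qed
  ultimately have "(\<forall>j<k. T (t + 1) w j = T t v j \<or> [int j = t + d] (mod int k) \<and> T (t + 1) w j = T t v j + 1)
      \<longleftrightarrow> (\<forall>j<k. w ! j = v ! j \<or> [int j = t] (mod int k) \<and> w ! j = v ! j + 1)"
    by simp
  moreover have "twist k d s c (u, x) = (u + d, map (T u x) [0..<k])" for u x
    by (simp add: twist_def T_def r_def)
  ultimately show ?thesis
    using assms True by (simp add: parcs_Z_Theta)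
qed (simp add: twist_def parcs_Z_Theta)

lemma twist_automorphism:
  assumes "k > 0"
  shows "twist k d s c \<in> automorphisms (Z_digraph Theta_inf k)"
proof -
  define V where "V = pverts (Z_digraph Theta_inf k)"
  define f where "f = twist k d s c"
  \<comment> \<open>The inverse: reflection undoes itself at the already shifted level
    \<open>t\<close>, and the indices rotate back by \<open>- d\<close>.\<close>
  define g where "g = (\<lambda>(t, y). (t - d, map (\<lambda>m. let j = rotate_index k (- d) m in
    if s j then changes k j t + c j - y ! j else y ! j - c j) [0..<k]))"
  have r: "rotate_index k d j < k" "rotate_index k d (rotate_index k (- d) j) = j"
      "rotate_index k (- d) (rotate_index k d j) = j" if "j < k" for d j
    using rotate_index[OF assms] that rotate_index(3)[OF assms that, of "- d"] by auto
  have "bij_betw f V V"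
  proof (rule bij_betw_byWitness[where f' = g])
    have "g (f (t, x)) = (t, x)" "f (g (t, x)) = (t, x)" if "length x = k" for t x
      by (auto simp: f_def g_def twist_def Let_def r that intro!: nth_equalityI)
    then show "\<forall>x\<in>V. g (f x) = x" "\<forall>y\<in>V. f (g y) = y"
      by (auto simp: V_def pverts_Z_Theta)
    show "f ` V \<subseteq> V" "g ` V \<subseteq> V"
      by (auto simp: V_def pverts_Z_Theta f_def g_def twist_def)
  qed
  moreover have "(f u, f v) \<in> parcs (Z_digraph Theta_inf k) \<longleftrightarrow> (u, v) \<in> parcs (Z_digraph Theta_inf k)"
    if "u \<in> V" "v \<in> V" for u v
    using that twist_arc_iff[OF assms] by (auto simp: V_def pverts_Z_Theta f_def)
  ultimately show ?thesis
    unfolding automorphisms_def f_def V_def by blast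
qed

text \<open>A twist aligns the starting levels, reflects the coordinates in which the binary choices
  of the two arcs differ, and translates to match the starting vertices.\<close>

lemma k_arc_transitive_Z_Theta:
  assumes k: "k > 0"
  shows "k_arc_transitive k (Z_digraph Theta_inf k)"
  unfolding k_arc_transitive_def
proof (intro ballI)
  fix a b assume ab: "a \<in> k_arcs (Z_digraph Theta_inf k) k" "b \<in> k_arcs (Z_digraph Theta_inf k) k"
  define i i' where "i = fst (a ! 0)" and "i' = fst (b ! 0)"
  define v v' where "v = snd (a ! 0)" and "v' = snd (b ! 0)"
  define d where "d = i' - i"
  define r where "r = rotate_index k d"
  define s where "s j \<longleftrightarrow> snd (a ! k) ! r j - v ! r j \<noteq> snd (b ! k) ! j - v' ! j" for j
  \<comment> \<open>The value that makes coordinate \<open>j\<close> agree at position 0.\<close>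
  define c where "c j = (if s j then v' ! j + v ! r j - changes k j i' else v' ! j - v ! r j)" for j
  have r: "r j < k" for j
    unfolding r_def by (rule rotate_index(1)[OF k])
  have "twist k d s c (a ! n) = b ! n" if n: "n \<le> k" for n
  proof -
    have an: "a ! n = (i + int n, snd (a ! n))"
      using k_arc_nth[OF k ab(1), of 0 n] n by (simp add: i_def prod_eq_iff)
    have bn: "b ! n = (i' + int n, snd (b ! n))" and len: "length (snd (b ! n)) = k"
      using k_arc_nth[OF k ab(2), of 0 n] n by (simp_all add: i'_def prod_eq_iff)
    have "(if s j then changes k j (i' + int n) + c j - snd (a ! n) ! r j else snd (a ! n) ! r j + c j)
        = snd (b ! n) ! j" if j: "j < k" for j
    proof -
      define D where "D = changes k j (i' + int n) - changes k j i'"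
      define x where "x = snd (a ! k) ! r j - v ! r j"
      define y where "y = snd (b ! k) ! j - v' ! j"
      \<comment> \<open>Corresponding coordinates of the two arcs have their opportunity at the same
        position, so one count \<open>D\<close> serves both.\<close>
      have "changes k j (i + int n + d) - changes k j (i + d) =
          changes k (r j) (i + int n) - changes k (r j) i"
        unfolding changes_rotate[OF k] r_def rotate_index_def by simp
      then have D: "changes k (r j) (i + int n) - changes k (r j) i = D"
        by (simp add: D_def d_def algebra_simps)
      have xy: "x \<in> {0, 1}" "y \<in> {0, 1}"
        unfolding x_def y_def v_def v'_def
        using k_arc_coordinate(1)[OF k ab(1) n r] k_arc_coordinate(1)[OF k ab(2) n j] by auto
      have "snd (a ! n) ! r j = v ! r j + x * D" "snd (b ! n) ! j = v' ! j + y * D"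
        using k_arc_coordinate(2)[OF k ab(1) n r] k_arc_coordinate(2)[OF k ab(2) n j] D
        by (simp_all add: i_def i'_def v_def v'_def x_def y_def D_def)
      \<comment> \<open>For binary \<open>x \<noteq> y\<close>, reflection gives
        \<open>D - x * D = y * D\<close>.\<close>
      moreover have "s j \<longleftrightarrow> x \<noteq> y"
        by (simp add: s_def x_def y_def)
      moreover have "changes k j (i' + int n) = D + changes k j i'"
        by (simp add: D_def)
      ultimately show ?thesis
        using xy by (auto simp: c_def)
    qed
    then have "map (\<lambda>j. if s j then changes k j (i' + int n) + c j - snd (a ! n) ! r j
        else snd (a ! n) ! r j + c j) [0..<k] = map ((!) (snd (b ! n))) [0..<k]"
      by (intro map_cong refl) (simp only: set_upt atLeastLessThan_iff)
    also have "\<dots> = snd (b ! n)"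
      using map_nth[of "snd (b ! n)"] by (simp only: len)
    finally have "map (\<lambda>j. if s j then changes k j (i' + int n) + c j - snd (a ! n) ! r j
        else snd (a ! n) ! r j + c j) [0..<k] = snd (b ! n)" .
    moreover have "i + int n + d = i' + int n"
      by (simp add: d_def)
    ultimately show ?thesis
      by (subst an, subst bn) (simp only: twist_def r_def prod.case)
  qed
  then have "map (twist k d s c) a = b"
    using ab by (auto simp: k_arcs_def intro!: nth_equalityI)
  then show "\<exists>f\<in>automorphisms (Z_digraph Theta_inf k). map f a = b"
    using twist_automorphism[OF k] by blast
qed

text \<open>A \<open>(k + 1)\<close>-arc meets coordinate \<open>0\<close> at both its first and its last step.  If exactly one
  of the two changes it, another \<open>(k + 1)\<close>-arc has the same end vertices, whereas a
  constant arc is determined by its end vertices.\<close>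

lemma not_Suc_k_arc_transitive_Z_Theta:
  assumes k: "k > 0"
  shows "\<not> k_arc_transitive (Suc k) (Z_digraph Theta_inf k)"
proof
  assume trans: "k_arc_transitive (Suc k) (Z_digraph Theta_inf k)"
  define z where "z = replicate k (0::int)"
  \<comment> \<open>Coordinate 0 rises just after position \<open>l\<close>: at the first step in
    \<open>A 0\<close>, at the last step in \<open>A k\<close>, and never in
    \<open>A (Suc k)\<close>.\<close>
  define A where "A l = map (\<lambda>n. (int n, if n \<le> l then z else z[0 := 1])) [0..<Suc (Suc k)]" for l
  have nth: "A l ! n = (int n, if n \<le> l then z else z[0 := 1])" if "n \<le> Suc k" for l n
    unfolding A_def using that by (simp del: upt_Suc)
  have len: "length (A l) = Suc (Suc k)" for l
    by (simp add: A_def)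
  \<comment> \<open>The rise leaves level \<open>l\<close>, where coordinate 0 may change if
    \<open>l\<close> is 0 or \<open>k\<close>; for larger \<open>l\<close> there is no rise within
    the arc.\<close>
  have arc: "A l \<in> k_arcs (Z_digraph Theta_inf k) (Suc k)" if l: "l = 0 \<or> l \<ge> k" for l
  proof -
    have "((int n, if n \<le> l then z else z[0 := 1]), (int (Suc n), if Suc n \<le> l then z else z[0 := 1]))
        \<in> parcs (Z_digraph Theta_inf k)" if "n \<le> k" for n
    proof -
      have "n = l \<Longrightarrow> n = 0 \<or> n = k"
        using l that by auto
      then have "n = l \<Longrightarrow> [0 = int n] (mod int k)"
        by (auto simp: cong_def)
      then show ?thesis
        by (cases n l rule: linorder_cases) (auto simp: parcs_Z_Theta z_def nth_list_update)
    qed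
    moreover have "set (A l) \<subseteq> pverts (Z_digraph Theta_inf k)"
      by (auto simp: A_def pverts_Z_Theta z_def)
    ultimately show ?thesis
      using len by (simp add: k_arcs_def nth)
  qed
  obtain f where f: "f \<in> automorphisms (Z_digraph Theta_inf k)" "map f (A k) = A (Suc k)"
    using trans arc[of k] arc[of "Suc k"] unfolding k_arc_transitive_def by auto
  \<comment> \<open>\<open>A 0\<close> and \<open>A k\<close> share their end vertices, so
    \<open>e\<close> has those of the constant arc \<open>A (Suc k)\<close>.\<close>
  define e where "e = map f (A 0)"
  have e: "e \<in> k_arcs (Z_digraph Theta_inf k) (Suc k)"
    unfolding e_def by (rule automorphism_map_k_arc[OF f(1) arc]) simp
  have image: "f (A k ! n) = A (Suc k) ! n" if "n \<le> Suc k" for n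
    using that len by (metis f(2) less_Suc_eq_le nth_map)
  have e_nth: "e ! n = f (A 0 ! n)" if "n \<le> Suc k" for n
    using that len by (simp add: e_def)
  have e0: "e ! 0 = (0, z)"
    using image[of 0] by (simp add: e_nth nth)
  have e_last: "e ! Suc k = (int (Suc k), z)"
    using image[of "Suc k"] by (simp add: e_nth nth)
  have le: "(1::nat) \<le> Suc k" by simp
  \<comment> \<open>Coordinates never decrease along \<open>e\<close> and agree at its ends, so they
    are constant.\<close>
  have "e ! 1 = (1, z)"
  proof -
    have "snd (e ! 1) ! j = z ! j" if "j < k" for j
      using k_arc_nth[OF k e, of 0 1] k_arc_nth[OF k e, of 1 "Suc k"] that
      by (auto simp: e0 e_last intro!: order_antisym)
    moreover have "fst (e ! 1) = 1" "length (snd (e ! 1)) = k"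
      using k_arc_nth[OF k e, of 0 1] by (auto simp: e0)
    ultimately show ?thesis
      by (auto simp: prod_eq_iff z_def intro!: nth_equalityI)
  qed
  also have "(1, z) = f (A k ! 1)"
    using image[OF le] nth[OF le, of "Suc k"] by simp
  finally have "f (A 0 ! 1) = f (A k ! 1)"
    by (simp add: e_nth)
  moreover have "inj_on f (pverts (Z_digraph Theta_inf k))"
    using f(1) by (auto simp: automorphisms_def bij_betw_def)
  moreover have "A 0 ! 1 \<in> pverts (Z_digraph Theta_inf k)" "A k ! 1 \<in> pverts (Z_digraph Theta_inf k)"
    using nth[OF le] by (auto simp: pverts_Z_Theta z_def)
  \<comment> \<open>At position 1 the arc \<open>A 0\<close> has already risen, while
    \<open>A k\<close> has not since \<open>k \<ge> 1\<close>.\<close>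
  ultimately have "A 0 ! 1 = A k ! 1"
    by (metis inj_onD)
  then have "z[0 := 1] = z"
    using nth[OF le, of 0] nth[OF le, of k] k by simp
  then have "z[0 := 1] ! 0 = z ! 0" by simp
  then show False
    using k by (simp add: z_def)
qed

theorem corollary14:
  fixes k :: nat
  assumes "k > 0"
  shows "polynomial_growth_of_degree (Z_digraph Theta_inf k) (k + 1) \<and>
         card (ends (Z_digraph Theta_inf k)) = 1 \<and>
         sharply_k_arc_transitive k (Z_digraph Theta_inf k)"
  using assms by (simp add: polynomial_growth_Z_Theta card_ends_Z_Theta sharply_k_arc_transitive_def
    k_arc_transitive_Z_Theta not_Suc_k_arc_transitive_Z_Theta del: One_nat_def)

end
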